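(* For every positive integer $n$, the quotients $H^{**}(n)/H_5(n)$, $H_4(n)/H_2(n)$ and $H_6(n)/H^*(n)$ are integers. If $n=p_1^{\varepsilon_1}\cdots p_r^{\varepsilon_r}$ with distinct primes $p_i$ and $\varepsilon_i\in\{1,2\}$, then $H_3(n)=H_1(n)$, $H_5(n)=H^*(n)$, $H_6(n)=H^{**}(n)=H^*(n)$ and $H_4(n)=H_2(n)$. If $n=p_1^{a_1}\cdots p_r^{a_r}$ with all $a_i$ odd, then $H_5(n)=H_2(n)$, $H_6(n)=H_1(n)$ and $H_3(n)=H_4(n)=H(n)$.
   Context: $\sigma(n)$, $d(n)$: sum and number of positive divisors of $n$. A divisor $d$ of $n$ is unitary if $\gcd(d,n/d)=1$; $\sigma^*(n)$, $d^*(n)$: sum and number of unitary divisors. A divisor $d$ of $n$ is bi-unitary if the greatest common unitary divisor of $d$ and $n/d$ is $1$; $\sigma^{**}(n)$, $d^{**}(n)$: sum and number of bi-unitary divisors. Define $H(n)=\frac{nd(n)}{\sigma(n)}$, $H^*(n)=\frac{nd^*(n)}{\sigma^*(n)}$, $H^{**}(n)=\frac{nd^{**}(n)}{\sigma^{**}(n)}$, $H_1(n)=\frac{nd(n)}{\sigma^*(n)}$, $H_2(n)=\frac{nd^*(n)}{\sigma(n)}$, $H_3(n)=\frac{nd(n)}{\sigma^{**}(n)}$, $H_4(n)=\frac{nd^{**}(n)}{\sigma(n)}$, $H_5(n)=\frac{nd^*(n)}{\sigma^{**}(n)}$, $H_6(n)=\frac{nd^{**}(n)}{\sigma^*(n)}$.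 *)

theory Defs
  imports Complex_Main "HOL-Computational_Algebra.Primes"
begin

definition unitary_divisor :: "nat \<Rightarrow> nat \<Rightarrow> bool" where
  "unitary_divisor d n \<longleftrightarrow> d dvd n \<and> coprime d (n div d)"

(* Greatest common unitary divisor, "greatest" in the usual order; 1 is always a candidate. *)
definition gcud :: "nat \<Rightarrow> nat \<Rightarrow> nat" where
  "gcud a b = Max {c. unitary_divisor c a \<and> unitary_divisor c b}"

definition biunitary_divisor :: "nat \<Rightarrow> nat \<Rightarrow> bool" where
  "biunitary_divisor d n \<longleftrightarrow> d dvd n \<and> gcud d (n div d) = 1"

(* The divisor functions below are only meaningful for n > 0. The suffixes _u and _b
   stand for the star (unitary) and double star (bi-unitary) variants. *)

definition sigma :: "nat \<Rightarrow> nat" where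
  "sigma n = \<Sum>{d. d dvd n}"

definition numdiv :: "nat \<Rightarrow> nat" where
  "numdiv n = card {d. d dvd n}"

definition sigma_u :: "nat \<Rightarrow> nat" where
  "sigma_u n = \<Sum>{d. unitary_divisor d n}"

definition numdiv_u :: "nat \<Rightarrow> nat" where
  "numdiv_u n = card {d. unitary_divisor d n}"

definition sigma_b :: "nat \<Rightarrow> nat" where
  "sigma_b n = \<Sum>{d. biunitary_divisor d n}"

definition numdiv_b :: "nat \<Rightarrow> nat" where
  "numdiv_b n = card {d. biunitary_divisor d n}"

definition H :: "nat \<Rightarrow> rat" where
  "H n = of_nat (n * numdiv n) / of_nat (sigma n)"

definition H_u :: "nat \<Rightarrow> rat" where
  "H_u n = of_nat (n * numdiv_u n) / of_nat (sigma_u n)"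

definition H_b :: "nat \<Rightarrow> rat" where
  "H_b n = of_nat (n * numdiv_b n) / of_nat (sigma_b n)"

definition H1 :: "nat \<Rightarrow> rat" where
  "H1 n = of_nat (n * numdiv n) / of_nat (sigma_u n)"

definition H2 :: "nat \<Rightarrow> rat" where
  "H2 n = of_nat (n * numdiv_u n) / of_nat (sigma n)"

definition H3 :: "nat \<Rightarrow> rat" where
  "H3 n = of_nat (n * numdiv n) / of_nat (sigma_b n)"

definition H4 :: "nat \<Rightarrow> rat" where
  "H4 n = of_nat (n * numdiv_b n) / of_nat (sigma n)"

definition H5 :: "nat \<Rightarrow> rat" where
  "H5 n = of_nat (n * numdiv_u n) / of_nat (sigma_b n)"

definition H6 :: "nat \<Rightarrow> rat" where
  "H6 n = of_nat (n * numdiv_b n) / of_nat (sigma_u n)"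

end

theory Submission
  imports Defs
begin

text \<open>
  Being a unitary or a bi-unitary divisor is a condition on one prime at a time: with \<open>i\<close> and \<open>k\<close>
  the exponents of \<open>p\<close> in \<open>d\<close> and \<open>n\<close>, unitarity says \<open>i \<in> {0, k}\<close> and bi-unitarity says
  \<open>2 i \<noteq> k\<close>. For \<open>k \<in> {1, 2}\<close> the two conditions agree, and for odd \<open>k\<close> the second one always holds.
  The number of divisors satisfying such a condition is multiplicative, so divisibility of
  \<open>d\<^sup>*\<^sup>*(n)\<close> by \<open>d\<^sup>*(n)\<close> reduces to prime powers, where the exponents \<open>i \<le> k\<close> with
  \<open>2 i \<noteq> k\<close> are paired off by \<open>i \<mapsto> k - i\<close>.
\<close>

section \<open>Divisor sets cut out by conditions on prime exponents\<close>

text \<open>The restriction to \<open>p dvd n\<close> matters: the bi-unitary condition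
  \<open>2 * i \<noteq> k\<close> fails at \<open>i = k = 0\<close>, so without it the set would be
  empty.\<close>

definition local_divisors :: "(nat \<Rightarrow> nat \<Rightarrow> bool) \<Rightarrow> nat \<Rightarrow> nat set" where
  "local_divisors Q n =
     {d. d dvd n \<and> (\<forall>p. prime p \<longrightarrow> p dvd n \<longrightarrow> Q (multiplicity p d) (multiplicity p n))}"

lemma local_divisors_cong:
  assumes "\<And>p i. prime p \<Longrightarrow> p dvd n \<Longrightarrow> i \<le> multiplicity p n \<Longrightarrow>
             Q i (multiplicity p n) \<longleftrightarrow> R i (multiplicity p n)"
    and "n > 0"
  shows "local_divisors Q n = local_divisors R n"
  unfolding local_divisors_def
  using assms by (auto simp: dvd_imp_multiplicity_le)

text \<open>Each prime factor of \<open>a * b\<close> divides exactly one of \<open>a\<close> and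
  \<open>b\<close>, and the exponents in \<open>d * e\<close> and \<open>a * b\<close> are those in
  the corresponding factors. The inverse map takes \<open>x\<close> to
  \<open>(gcd x a, gcd x b)\<close>.\<close>

lemma local_divisors_mult:
  assumes "coprime a b" "a > 0" "b > 0"
  shows "bij_betw (\<lambda>(d, e). d * e) (local_divisors Q a \<times> local_divisors Q b)
           (local_divisors Q (a * b))"
proof -
  \<comment> \<open>The equivalence serves both inclusions of the image equality: one direction
    builds members, the other splits them.\<close>
  have mult: "d * e \<in> local_divisors Q (a * b) \<longleftrightarrow>
                d \<in> local_divisors Q a \<and> e \<in> local_divisors Q b"
    if "d dvd a" "e dvd b" for d e
  proof -
    have pos: "d \<noteq> 0" "e \<noteq> 0" using that assms by auto
    have A: "multiplicity p (d * e) = multiplicity p d \<and> multiplicity p (a * b) = multiplicity p a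
             \<and> \<not> p dvd b" if "prime p" "p dvd a" for p
    proof -
      have nb: "\<not> p dvd b" using that assms(1) by (meson coprime_common_divisor not_prime_unit)
      then have "\<not> p dvd e" using \<open>e dvd b\<close> dvd_trans by blast
      with nb show ?thesis using that pos assms
        by (simp add: prime_elem_multiplicity_mult_distrib not_dvd_imp_multiplicity_0)
    qed
    have B: "multiplicity p (d * e) = multiplicity p e \<and> multiplicity p (a * b) = multiplicity p b"
      if "prime p" "p dvd b" for p
    proof -
      have na: "\<not> p dvd a" using that assms(1) by (meson coprime_common_divisor not_prime_unit)
      then have "\<not> p dvd d" using \<open>d dvd a\<close> dvd_trans by blast
      with na show ?thesis using that pos assms
        by (simp add: prime_elem_multiplicity_mult_distrib not_dvd_imp_multiplicity_0)
    qed
    show ?thesis unfolding local_divisors_def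
      using A B that by (auto simp: prime_dvd_mult_iff mult_dvd_mono)
  qed
  show ?thesis
  proof (rule bij_betw_imageI)
    have gcds: "gcd (d * e) a = d \<and> gcd (d * e) b = e" if "d dvd a" "e dvd b" for d e
    proof -
      have "coprime e a" "coprime d b"
        using that assms(1) by (meson coprime_commute coprime_divisors dvd_refl)+
      then show ?thesis using that
        by (simp add: gcd_mult_left_right_cancel gcd_mult_left_left_cancel coprime_commute
            gcd_proj1_iff)
    qed
    show "inj_on (\<lambda>(d, e). d * e) (local_divisors Q a \<times> local_divisors Q b)"
    proof (rule inj_onI, clarify)
      fix d e d' e'
      assume "d \<in> local_divisors Q a" "e \<in> local_divisors Q b"
        "d' \<in> local_divisors Q a" "e' \<in> local_divisors Q b" and eq: "d * e = d' * e'"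
      then have "d dvd a" "e dvd b" "d' dvd a" "e' dvd b"
        by (auto simp: local_divisors_def)
      then show "d = d' \<and> e = e'" using gcds eq by metis
    qed
    show "(\<lambda>(d, e). d * e) ` (local_divisors Q a \<times> local_divisors Q b) = local_divisors Q (a * b)"
    proof (intro equalityI subsetI)
      fix x assume "x \<in> (\<lambda>(d, e). d * e) ` (local_divisors Q a \<times> local_divisors Q b)"
      then obtain d e where "x = d * e" "d \<in> local_divisors Q a" "e \<in> local_divisors Q b" by auto
      then show "x \<in> local_divisors Q (a * b)"
        using mult by (simp add: local_divisors_def)
    next
      fix x assume x: "x \<in> local_divisors Q (a * b)"
      then have "x dvd a * b" by (simp add: local_divisors_def)
      then obtain d e where "x = d * e" "d dvd a" "e dvd b" using division_decomp by blast
      then show "x \<in> (\<lambda>(d, e). d * e) ` (local_divisors Q a \<times> local_divisors Q b)"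
        using mult x by (auto intro!: image_eqI[of _ _ "(d, e)"])
    qed
  qed
qed

lemma card_local_divisors_mult:
  assumes "coprime a b" "a > 0" "b > 0"
  shows "card (local_divisors Q (a * b)) = card (local_divisors Q a) * card (local_divisors Q b)"
  using bij_betw_same_card[OF local_divisors_mult[OF assms, of Q]]
  by (simp add: card_cartesian_product)

text \<open>The divisors are the \<open>p ^ i\<close> with \<open>i \<le> k\<close>, and
  \<open>p\<close> is the only prime to test. At \<open>k = 0\<close> no prime is tested, while the
  right side would still ask for \<open>Q 0 0\<close>.\<close>

lemma card_local_divisors_prime_power:
  assumes "prime p" "k > 0"
  shows "card (local_divisors Q (p ^ k)) = card {i. i \<le> k \<and> Q i k}"
proof -
  have "local_divisors Q (p ^ k) = (\<lambda>i. p ^ i) ` {i. i \<le> k \<and> Q i k}"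
  proof -
    have "q dvd p ^ k \<longleftrightarrow> q = p" if "prime q" for q
      using that assms by (auto simp: prime_dvd_power_iff dest: primes_dvd_imp_eq)
    then have "(\<forall>q. prime q \<longrightarrow> q dvd p ^ k \<longrightarrow> Q (multiplicity q d) (multiplicity q (p ^ k))) \<longleftrightarrow>
        Q (multiplicity p d) k" for d
      using assms(1) by auto
    then show ?thesis
      using assms by (auto simp: local_divisors_def divides_primepow_nat)
  qed
  moreover have "inj_on (\<lambda>i. p ^ i) {i. i \<le> k \<and> Q i k}"
    using assms(1) by (auto intro!: inj_onI simp: prime_power_inj)
  ultimately show ?thesis by (simp add: card_image)
qed

text \<open>Strong induction splits off the full power of one prime. Both counts factor; the
  hypothesis covers the prime power and the induction the cofactor.\<close>

lemma card_local_divisors_dvd: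
  assumes "\<And>k. k > 0 \<Longrightarrow> card {i. i \<le> k \<and> Q i k} dvd card {i. i \<le> k \<and> R i k}"
    and "n > 0"
  shows "card (local_divisors Q n) dvd card (local_divisors R n)"
  using assms(2)
proof (induction n rule: less_induct)
  case (less n)
  show ?case
  proof (cases "n = 1")
    case True
    have "local_divisors S 1 = {1}" for S by (auto simp: local_divisors_def)
    with True show ?thesis by simp
  next
    case False
    then obtain p where p: "prime p" "p dvd n" using prime_factor_nat by blast
    define k where "k = multiplicity p n"
    obtain m where m: "n = p ^ k * m" "\<not> p dvd m"
      using multiplicity_decompose'[of n p] p less.prems unfolding k_def
      by (metis not_prime_unit less_numeral_extra(3))
    have "m > 0" using m less.prems by (cases m) auto
    have "k > 0" using m p by (cases k) auto
    then have "1 < p ^ k" using p(1) prime_gt_1_nat one_less_power by blast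
    then have "m < n" using m \<open>m > 0\<close> by simp
    have cop: "coprime (p ^ k) m" using p(1) m(2) by (simp add: prime_imp_coprime)
    show ?thesis
      unfolding m(1) using p(1) \<open>m > 0\<close> \<open>k > 0\<close> assms(1)[OF \<open>k > 0\<close>] less.IH[OF \<open>m < n\<close> \<open>m > 0\<close>]
      by (simp add: card_local_divisors_mult[OF cop] prime_gt_0_nat
          card_local_divisors_prime_power mult_dvd_mono)
  qed
qed

section \<open>Unitary and bi-unitary divisors in terms of exponents\<close>

text \<open>With \<open>n = d * e\<close> exponents add, so equal exponents of \<open>p\<close> in
  \<open>d\<close> and \<open>n\<close> mean that \<open>p\<close> does not divide \<open>e\<close>;
  coprimality can be tested on primes.\<close>

lemma unitary_divisor_iff_multiplicity:
  assumes "n > 0"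
  shows "unitary_divisor d n \<longleftrightarrow>
    d dvd n \<and> (\<forall>p. prime p \<longrightarrow> p dvd d \<longrightarrow> multiplicity p d = multiplicity p n)"
proof (cases "d dvd n")
  case True
  then obtain e where n: "n = d * e" by blast
  then have pos: "d > 0" "e > 0" using assms by auto
  have "coprime d e \<longleftrightarrow> (\<forall>p. prime p \<longrightarrow> p dvd d \<longrightarrow> \<not> p dvd e)"
  proof
    assume "coprime d e"
    then show "\<forall>p. prime p \<longrightarrow> p dvd d \<longrightarrow> \<not> p dvd e"
      using coprime_common_divisor not_prime_unit by blast
  next
    assume no_prime: "\<forall>p. prime p \<longrightarrow> p dvd d \<longrightarrow> \<not> p dvd e"
    show "coprime d e"
    proof (rule coprimeI)
      fix c assume "c dvd d" "c dvd e"
      with no_prime have "c = 1" using prime_factor_nat[of c] dvd_trans by blast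
      then show "is_unit c" by simp
    qed
  qed
  also have "\<dots> \<longleftrightarrow> (\<forall>p. prime p \<longrightarrow> p dvd d \<longrightarrow> multiplicity p d = multiplicity p n)"
  proof -
    have "\<not> p dvd e \<longleftrightarrow> multiplicity p d = multiplicity p n" if "prime p" for p
      using that pos prime_multiplicity_gt_zero_iff[of p e]
      by (auto simp: n prime_elem_multiplicity_mult_distrib)
    then show ?thesis by blast
  qed
  finally show ?thesis using n pos by (simp add: unitary_divisor_def)
qed (simp add: unitary_divisor_def)

text \<open>A prime with the same exponent \<open>k > 0\<close> in \<open>a\<close> and
  \<open>b\<close> yields the common unitary divisor \<open>p ^ k > 1\<close>. Conversely, any prime
  factor of a common unitary divisor has equal exponents in \<open>a\<close> and
  \<open>b\<close>.\<close>

lemma gcud_eq_1_iff: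
  assumes "a > 0" "b > 0"
  shows "gcud a b = 1 \<longleftrightarrow> (\<forall>p. prime p \<longrightarrow> p dvd a \<longrightarrow> multiplicity p a \<noteq> multiplicity p b)"
    (is "_ \<longleftrightarrow> ?R")
proof -
  let ?S = "{c. unitary_divisor c a \<and> unitary_divisor c b}"
  have "?S \<subseteq> {c. c dvd a}" by (auto simp: unitary_divisor_def)
  then have fin: "finite ?S" using finite_subset finite_divisors_nat assms(1) by blast
  show ?thesis
  proof
    assume g: "gcud a b = 1"
    show ?R
    proof (intro allI impI notI)
      fix p assume p: "prime p" "p dvd a" and eq: "multiplicity p a = multiplicity p b"
      let ?k = "multiplicity p a"
      have "?k > 0" using p assms by (simp add: prime_multiplicity_gt_zero_iff)
      then have gt: "1 < p ^ ?k" using p(1) prime_gt_1_nat one_less_power by blast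
      have same: "q = p" if "prime q" "q dvd p ^ ?k" for q
        using that p(1) prime_dvd_power primes_dvd_imp_eq by blast
      have "multiplicity p (p ^ ?k) = ?k" using p(1) by simp
      then have "unitary_divisor (p ^ ?k) a" "unitary_divisor (p ^ ?k) b"
        using assms eq multiplicity_dvd[of p a] multiplicity_dvd[of p b]
        by (auto simp: unitary_divisor_iff_multiplicity dest!: same)
      then have "p ^ ?k \<le> gcud a b" unfolding gcud_def using fin by (intro Max_ge) auto
      with g gt show False by simp
    qed
  next
    assume R: ?R
    have "c = 1" if "c \<in> ?S" for c
    proof (rule ccontr)
      assume "c \<noteq> 1"
      then obtain p where "prime p" "p dvd c" using prime_factor_nat by blast
      moreover have "unitary_divisor c a" "unitary_divisor c b" using that by auto
      ultimately have "p dvd a" "multiplicity p a = multiplicity p b"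
        using assms by (auto simp: unitary_divisor_iff_multiplicity dest: dvd_trans)
      then show False using R \<open>prime p\<close> by blast
    qed
    moreover have "1 \<in> ?S" by (simp add: unitary_divisor_def)
    ultimately have "?S = {1}" by blast
    then show "gcud a b = 1" by (simp add: gcud_def)
  qed
qed

lemma unitary_divisors_eq:
  assumes "n > 0"
  shows "{d. unitary_divisor d n} = local_divisors (\<lambda>i k. i = 0 \<or> i = k) n"
proof -
  have "multiplicity p d = 0 \<longleftrightarrow> \<not> p dvd d" if "d dvd n" "prime p" for d p
  proof -
    have "d > 0" using that assms by (auto intro: dvd_pos_nat)
    then show ?thesis
      using prime_multiplicity_gt_zero_iff[of p d] that by auto
  qed
  then show ?thesis
    using assms
    by (auto simp: local_divisors_def unitary_divisor_iff_multiplicity dest: dvd_trans)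
qed

text \<open>The exponents of \<open>p\<close> in \<open>d\<close> and \<open>n div d\<close> are
  \<open>i\<close> and \<open>k - i\<close>, which agree iff \<open>2 * i = k\<close>. Passing from
  primes dividing \<open>d\<close> to primes dividing \<open>n\<close> only adds cases with
  \<open>i = 0 < k\<close>, where \<open>2 * i \<noteq> k\<close> is automatic.\<close>

lemma biunitary_divisors_eq:
  assumes "n > 0"
  shows "{d. biunitary_divisor d n} = local_divisors (\<lambda>i k. 2 * i \<noteq> k) n"
proof -
  have "gcud d (n div d) = 1 \<longleftrightarrow>
      (\<forall>p. prime p \<longrightarrow> p dvd n \<longrightarrow> 2 * multiplicity p d \<noteq> multiplicity p n)" if dvd: "d dvd n" for d
  proof -
    from dvd obtain e where n: "n = d * e" by blast
    then have pos: "d > 0" "e > 0" using assms by auto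
    have "(p dvd d \<longrightarrow> multiplicity p d \<noteq> multiplicity p e) \<longleftrightarrow>
          (p dvd n \<longrightarrow> 2 * multiplicity p d \<noteq> multiplicity p n)" if p: "prime p" for p
    proof -
      have "multiplicity p n = multiplicity p d + multiplicity p e"
        using p pos by (simp add: n prime_elem_multiplicity_mult_distrib)
      moreover have "p dvd d \<longleftrightarrow> multiplicity p d > 0" "p dvd n \<longleftrightarrow> multiplicity p n > 0"
        using p pos assms by (auto simp: prime_multiplicity_gt_zero_iff)
      ultimately show ?thesis by auto
    qed
    then show ?thesis using gcud_eq_1_iff[OF pos] pos by (simp add: n)
  qed
  then show ?thesis by (auto simp: biunitary_divisor_def local_divisors_def)
qed

section \<open>Divisibility between the two divisor counts\<close>

text \<open>Of the \<open>k + 1\<close> exponents the midpoint is lost exactly when \<open>k\<close>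
  is even, leaving \<open>k\<close> for even \<open>k\<close> and \<open>k + 1\<close> for odd
  \<open>k\<close>.\<close>

lemma even_card_non_half:
  fixes k :: nat
  shows "even (card {i. i \<le> k \<and> 2 * i \<noteq> k})"
proof (cases "even k")
  case True
  then obtain j where "k = 2 * j" by blast
  then have "{i. i \<le> k \<and> 2 * i \<noteq> k} = {..k} - {j}" by auto
  then show ?thesis using \<open>k = 2 * j\<close> by simp
next
  case False
  then have "{i. i \<le> k \<and> 2 * i \<noteq> k} = {..k}" by auto
  then show ?thesis using False by simp
qed

lemma numdiv_u_dvd_numdiv_b:
  assumes "n > 0"
  shows "numdiv_u n dvd numdiv_b n"
  unfolding numdiv_u_def numdiv_b_def unitary_divisors_eq[OF assms] biunitary_divisors_eq[OF assms]
proof (rule card_local_divisors_dvd[OF _ assms])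
  fix k :: nat assume "k > 0"
  \<comment> \<open>As \<open>k > 0\<close>, the exponents \<open>0\<close> and \<open>k\<close> are
    distinct, so the local unitary count is exactly 2 and evenness of the other count
    suffices.\<close>
  have "{i. i \<le> k \<and> (i = 0 \<or> i = k)} = {0, k}" by auto
  with \<open>k > 0\<close> have "card {i. i \<le> k \<and> (i = 0 \<or> i = k)} = 2" by simp
  then show "card {i. i \<le> k \<and> (i = 0 \<or> i = k)} dvd card {i. i \<le> k \<and> 2 * i \<noteq> k}"
    using even_card_non_half by simp
qed

section \<open>Numbers with prescribed exponents\<close>

text \<open>Turns a hypothesis on the exponents of an indexed factorization into one on
  multiplicities of primes.\<close>

lemma multiplicity_prod_inj:
  fixes p e :: "nat \<Rightarrow> nat"
  assumes "inj_on p I" "finite I" "\<And>i. i \<in> I \<Longrightarrow> prime (p i)"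
    and q: "prime q" "q dvd (\<Prod>i\<in>I. p i ^ e i)"
  shows "\<exists>i\<in>I. q = p i \<and> multiplicity q (\<Prod>i\<in>I. p i ^ e i) = e i"
proof -
  obtain i where i: "i \<in> I" "q dvd p i ^ e i"
    using q \<open>finite I\<close> by (auto simp: prime_dvd_prod_iff)
  then have qi: "q = p i" using q(1) assms(3) prime_dvd_power primes_dvd_imp_eq by blast
  \<comment> \<open>Indexing by the primes themselves, which injectivity of \<open>p\<close>
    permits, gives the form in which exponents can be read off.\<close>
  have "(\<Prod>i\<in>I. p i ^ e i) = (\<Prod>q\<in>p ` I. q ^ e (inv_into I p q))"
    using assms(1) by (simp add: prod.reindex)
  moreover have "multiplicity q (\<Prod>q\<in>p ` I. q ^ e (inv_into I p q)) = e i"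
    using assms(2,3) i(1) assms(1) qi q(1) by (subst multiplicity_prod_prime_powers) auto
  ultimately show ?thesis using i(1) qi by auto
qed

text \<open>For \<open>k = 1\<close> nothing is excluded and for \<open>k = 2\<close> only
  \<open>i = 1\<close> is, so \<open>i = 0\<close> and \<open>i = k\<close> remain in both
  cases.\<close>

lemma biunitary_eq_unitary:
  assumes "n > 0" "\<And>p. prime p \<Longrightarrow> p dvd n \<Longrightarrow> multiplicity p n \<in> {1, 2}"
  shows "biunitary_divisor d n \<longleftrightarrow> unitary_divisor d n"
proof -
  have "local_divisors (\<lambda>i k. 2 * i \<noteq> k) n = local_divisors (\<lambda>i k. i = 0 \<or> i = k) n"
  proof (rule local_divisors_cong[OF _ assms(1)])
    fix p i assume "prime p" "p dvd n" "i \<le> multiplicity p n"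
    then show "2 * i \<noteq> multiplicity p n \<longleftrightarrow> i = 0 \<or> i = multiplicity p n"
      using assms(2)[of p] by auto
  qed
  then show ?thesis
    using unitary_divisors_eq[OF assms(1)] biunitary_divisors_eq[OF assms(1)] by blast
qed

lemma biunitary_eq_dvd:
  assumes "n > 0" "\<And>p. prime p \<Longrightarrow> p dvd n \<Longrightarrow> odd (multiplicity p n)"
  shows "biunitary_divisor d n \<longleftrightarrow> d dvd n"
proof -
  have "local_divisors (\<lambda>i k. 2 * i \<noteq> k) n = {d. d dvd n}"
    using assms(2) unfolding local_divisors_def by (metis dvd_triv_left)
  then show ?thesis using biunitary_divisors_eq[OF assms(1)] by blast
qed

lemma of_nat_quotient_Ints:
  fixes n a b s :: nat
  assumes "b dvd a"
  shows "(of_nat (n * a) / of_nat s) / (of_nat (n * b) / of_nat s) \<in> (\<int> :: rat set)"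
proof -
  obtain c where "a = b * c" using assms by blast
  then have "(of_nat (n * a) / of_nat s) / (of_nat (n * b) / of_nat s) =
      (if n = 0 \<or> b = 0 \<or> s = 0 then 0 else of_nat c :: rat)"
    by auto
  then show ?thesis by simp
qed

theorem theorem6:
  fixes n :: nat
  assumes "n > 0"
  shows "(H_b n / H5 n \<in> \<int> \<and> H4 n / H2 n \<in> \<int> \<and> H6 n / H_u n \<in> \<int>) \<and>
    (\<forall>(r::nat) (p::nat \<Rightarrow> nat) (e::nat \<Rightarrow> nat).
       inj_on p {1..r} \<and> (\<forall>i\<in>{1..r}. prime (p i) \<and> e i \<in> {1, 2}) \<and>
       n = (\<Prod>i=1..r. p i ^ e i) \<longrightarrow>
       H3 n = H1 n \<and> H5 n = H_u n \<and> H6 n = H_b n \<and> H_b n = H_u n \<and> H4 n = H2 n) \<and>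
    (\<forall>(r::nat) (p::nat \<Rightarrow> nat) (a::nat \<Rightarrow> nat).
       inj_on p {1..r} \<and> (\<forall>i\<in>{1..r}. prime (p i) \<and> odd (a i)) \<and>
       n = (\<Prod>i=1..r. p i ^ a i) \<longrightarrow>
       H5 n = H2 n \<and> H6 n = H1 n \<and> H3 n = H4 n \<and> H4 n = H n)"
proof (intro conjI[of "_ \<and> _"] allI impI)
  \<comment> \<open>Within each quotient both terms have the same divisor sum as denominator
    (\<open>sigma_b\<close>, \<open>sigma\<close>, \<open>sigma_u\<close> in turn), so only
    \<open>numdiv_b n / numdiv_u n\<close> remains.\<close>
  show "H_b n / H5 n \<in> \<int> \<and> H4 n / H2 n \<in> \<int> \<and> H6 n / H_u n \<in> \<int>"
    unfolding H_b_def H5_def H4_def H2_def H6_def H_u_def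
    using of_nat_quotient_Ints[OF numdiv_u_dvd_numdiv_b[OF assms]] by blast
next
  show "(\<forall>(r::nat) (p::nat \<Rightarrow> nat) (e::nat \<Rightarrow> nat).
       inj_on p {1..r} \<and> (\<forall>i\<in>{1..r}. prime (p i) \<and> e i \<in> {1, 2}) \<and>
       n = (\<Prod>i=1..r. p i ^ e i) \<longrightarrow>
       H3 n = H1 n \<and> H5 n = H_u n \<and> H6 n = H_b n \<and> H_b n = H_u n \<and> H4 n = H2 n) \<and>
    (\<forall>(r::nat) (p::nat \<Rightarrow> nat) (a::nat \<Rightarrow> nat).
       inj_on p {1..r} \<and> (\<forall>i\<in>{1..r}. prime (p i) \<and> odd (a i)) \<and>
       n = (\<Prod>i=1..r. p i ^ a i) \<longrightarrow>
       H5 n = H2 n \<and> H6 n = H1 n \<and> H3 n = H4 n \<and> H4 n = H n)"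
  proof (intro conjI[of "All _" "All _"] allI impI; elim conjE)
    fix r :: nat and p e :: "nat \<Rightarrow> nat"
    assume inj: "inj_on p {1..r}" and pe: "\<forall>i\<in>{1..r}. prime (p i) \<and> e i \<in> {1, 2}"
      and n: "n = (\<Prod>i=1..r. p i ^ e i)"
    have "multiplicity q n \<in> {1, 2}" if "prime q" "q dvd n" for q
      using multiplicity_prod_inj[OF inj, of q e] pe that unfolding n by fastforce
    then have "biunitary_divisor d n \<longleftrightarrow> unitary_divisor d n" for d
      by (rule biunitary_eq_unitary[OF assms])
    \<comment> \<open>Equal divisor sets have equal sums and cardinalities, after which all the
      identities hold by definition.\<close>
    then have "sigma_b n = sigma_u n" "numdiv_b n = numdiv_u n"
      by (simp_all add: sigma_b_def sigma_u_def numdiv_b_def numdiv_u_def)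
    then show "H3 n = H1 n \<and> H5 n = H_u n \<and> H6 n = H_b n \<and> H_b n = H_u n \<and> H4 n = H2 n"
      by (simp add: H3_def H1_def H5_def H_u_def H6_def H_b_def H4_def H2_def)
  next
    fix r :: nat and p a :: "nat \<Rightarrow> nat"
    assume inj: "inj_on p {1..r}" and pa: "\<forall>i\<in>{1..r}. prime (p i) \<and> odd (a i)"
      and n: "n = (\<Prod>i=1..r. p i ^ a i)"
    have "odd (multiplicity q n)" if "prime q" "q dvd n" for q
      using multiplicity_prod_inj[OF inj, of q a] pa that unfolding n by fastforce
    then have "biunitary_divisor d n \<longleftrightarrow> d dvd n" for d
      by (rule biunitary_eq_dvd[OF assms])
    then have "sigma_b n = sigma n" "numdiv_b n = numdiv n"
      by (simp_all add: sigma_b_def sigma_def numdiv_b_def numdiv_def)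
    then show "H5 n = H2 n \<and> H6 n = H1 n \<and> H3 n = H4 n \<and> H4 n = H n"
      by (simp add: H3_def H1_def H5_def H6_def H4_def H2_def H_def)
  qed
qed

end
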